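(* Let $A\in\mathbb{R}^{m\times n}$ have full row rank and let $b\in\mathbb{R}^m\setminus\{0\}$. The function $$F(x):=\frac{\|x\|_1}{\|x\|}+\delta_{A^{-1}\{b\}}(x)$$ is a KL function with exponent $\frac12$.
   Context: $\|\cdot\|$ is the Euclidean norm, $\|\cdot\|_1$ the $\ell_1$ norm, $A^{-1}\{b\}=\{x\in\mathbb{R}^n:Ax=b\}$, and $\delta_C$ is the indicator function of $C$ ($0$ on $C$, $\infty$ off $C$). Since $b\ne0$, $0\notin A^{-1}\{b\}$, and $F(x)=\infty$ whenever $Ax\neq b$ (in particular at $x=0$). For a proper closed (lower semicontinuous) $h:\mathbb{R}^n\to(-\infty,\infty]$ and $\bar x\in\mathrm{dom}\,h=\{h<\infty\}$, the regular subdifferential is $\widehat\partial h(\bar x)=\{v:\liminf_{x\to\bar x,x\ne\bar x}\frac{h(x)-h(\bar x)-\langle v,x-\bar x\rangle}{\|x-\bar x\|}\ge0\}$, and the limiting subdifferential is $\partial h(\bar x)=\{v:\exists\,x^t\to\bar x \text{ with } h(x^t)\to h(\bar x) \text{ and } v^t\in\widehat\partial h(x^t)\text{ with }v^t\to v\}$; both are empty off $\mathrm{dom}\,h$, and $\mathrm{dom}\,\partial h:=\{x:\partial h(x)\neq\emptyset\}$. $h$ satisfies the Kurdyka-Łojasiewicz (KL) property with exponent $\theta\in[0,1)$ at $\widehat x\in\mathrm{dom}\,\partial h$ if there are $a\in(0,\infty]$, $a_0>0$ and a neighborhood $U$ of $\widehat x$ such that, with $\varphi(\nu)=a_0\nu^{1-\theta}$,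 one has $\varphi'(h(x)-h(\widehat x))\,\mathrm{dist}(0,\partial h(x))\ge1$ for every $x\in U$ with $h(\widehat x)<h(x)<h(\widehat x)+a$ (with $\mathrm{dist}(0,\emptyset)=\infty$). A proper closed function is a KL function with exponent $\theta$ if it satisfies the KL property with exponent $\theta$ at every point of $\mathrm{dom}\,\partial h$. *)

theory Defs
  imports "HOL-Analysis.Analysis"
begin

text \<open>
  Extended-valued functions are modelled with values in \<^typ>\<open>ereal\<close>. Properness is a separate
  hypothesis, since the type also contains \<open>-\<infinity>\<close>.
\<close>

definition edom :: "('a \<Rightarrow> ereal) \<Rightarrow> 'a set" where
  "edom h = {x. h x < \<infinity>}"

definition proper :: "('a \<Rightarrow> ereal) \<Rightarrow> bool" where
  "proper h \<longleftrightarrow> (\<forall>x. h x \<noteq> -\<infinity>) \<and> edom h \<noteq> {}"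

definition lsc :: "('a::topological_space \<Rightarrow> ereal) \<Rightarrow> bool" where
  "lsc h \<longleftrightarrow> (\<forall>x. h x \<le> Liminf (at x) h)"

text \<open>
  The filter \<^term>\<open>at x\<close> is punctured, as the difference quotient requires. The subdifferentials
  are only meaningful for proper functions: then \<^term>\<open>h x\<close> is finite for \<open>x \<in> edom h\<close>, and the
  extended subtraction below has no undefined case.
\<close>

definition regular_subdiff :: "('a::euclidean_space \<Rightarrow> ereal) \<Rightarrow> 'a \<Rightarrow> 'a set" where
  "regular_subdiff h x =
     {v. x \<in> edom h \<and>
         0 \<le> Liminf (at x) (\<lambda>y. (h y - h x - ereal (v \<bullet> (y - x))) / ereal (norm (y - x)))}"

definition limiting_subdiff :: "('a::euclidean_space \<Rightarrow> ereal) \<Rightarrow> 'a \<Rightarrow> 'a set" where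
  "limiting_subdiff h x =
     {v. x \<in> edom h \<and>
         (\<exists>xs vs. xs \<longlonglongrightarrow> x \<and> (\<lambda>t. h (xs t)) \<longlonglongrightarrow> h x \<and>
                  (\<forall>t. vs t \<in> regular_subdiff h (xs t)) \<and> vs \<longlonglongrightarrow> v)}"

definition subdiff_dom :: "('a::euclidean_space \<Rightarrow> ereal) \<Rightarrow> 'a set" where
  "subdiff_dom h = {x. limiting_subdiff h x \<noteq> {}}"

text \<open>
  An \<^typ>\<open>ereal\<close>-valued infimum is used because the distance to the empty set has to be \<open>\<infinity>\<close>,
  whereas \<^term>\<open>infdist x {} = 0\<close>.
\<close>

definition edist_set :: "'a::metric_space \<Rightarrow> 'a set \<Rightarrow> ereal" where
  "edist_set x S = (INF y\<in>S. ereal (dist x y))"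

text \<open>
  In \<open>KL_at\<close> the argument of the derivative is always a positive real number (for proper \<^term>\<open>h\<close>),
  so neither \<^const>\<open>real_of_ereal\<close> nor \<^const>\<open>deriv\<close> takes a default value.
\<close>

definition KL_at :: "real \<Rightarrow> ('a::euclidean_space \<Rightarrow> ereal) \<Rightarrow> 'a \<Rightarrow> bool" where
  "KL_at \<theta> h z \<longleftrightarrow>
     (\<exists>(a::ereal) (a0::real) U. 0 < a \<and> 0 < a0 \<and> open U \<and> z \<in> U \<and>
        (\<forall>x\<in>U. h z < h x \<and> h x < h z + a \<longrightarrow>
           1 \<le> ereal (deriv (\<lambda>\<nu>. a0 * \<nu> powr (1 - \<theta>)) (real_of_ereal (h x - h z)))
                 * edist_set 0 (limiting_subdiff h x)))"

definition KL_function :: "real \<Rightarrow> ('a::euclidean_space \<Rightarrow> ereal) \<Rightarrow> bool" where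
  "KL_function \<theta> h \<longleftrightarrow>
     0 \<le> \<theta> \<and> \<theta> < 1 \<and> proper h \<and> lsc h \<and> (\<forall>z\<in>subdiff_dom h. KL_at \<theta> h z)"

definition l1_norm :: "real ^ 'n \<Rightarrow> real" where
  "l1_norm x = (\<Sum>i\<in>UNIV. \<bar>x $ i\<bar>)"

definition indicator_fun :: "'a set \<Rightarrow> 'a \<Rightarrow> ereal" where
  "indicator_fun C x = (if x \<in> C then 0 else \<infinity>)"

end

theory Submission
  imports Defs
begin

text \<open>
  Exponent \<open>1/2\<close> at a point \<open>z\<close> with value \<open>c = \<parallel>z\<parallel>\<^sub>1 / \<parallel>z\<parallel>\<close> amounts to a bound
  \<open>F x - c \<le> M \<parallel>v\<parallel>\<^sup>2\<close> for all points \<open>x\<close> near \<open>z\<close> with value slightly above \<open>c\<close> and all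
  subgradients \<open>v\<close> at \<open>x\<close>. Such a bound passes to limits, so regular subgradients suffice
  (\<open>KL_at_halfI\<close>).

  The bound is obtained one sign pattern at a time. Let \<open>s\<close> be the sign vector of \<open>x\<close> and let \<open>W\<close>
  consist of the directions in the kernel of \<open>A\<close> that vanish wherever \<open>s\<close> does. Close to \<open>x\<close> the
  norm \<open>\<parallel>\<cdot>\<parallel>\<^sub>1\<close> agrees with the linear form \<open>\<langle>s, \<cdot>\<rangle>\<close> on \<open>x + W\<close>, so there \<open>F\<close> is the smooth function
  \<open>\<langle>s, y\<rangle> / \<parallel>y\<parallel>\<close>, and a regular subgradient \<open>v\<close> bounds its derivative in every direction of \<open>W\<close>
  by \<open>\<parallel>v\<parallel>\<close>.

  For \<open>x\<close> close to \<open>z\<close> the signs of \<open>x\<close> extend those of \<open>z\<close>. Hence \<open>z\<close> itself lies in \<open>x + W\<close> and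
  \<open>\<langle>s, z\<rangle> = \<parallel>z\<parallel>\<^sub>1\<close>. With \<open>g = F x\<close>, the quadratic \<open>Q y = (\<langle>s, y\<rangle>\<^sup>2 - c\<^sup>2 \<parallel>y\<parallel>\<^sup>2) / 2\<close> vanishes at \<open>z\<close>,
  its value at \<open>x\<close> is \<open>(g\<^sup>2 - c\<^sup>2) \<parallel>x\<parallel>\<^sup>2 / 2\<close>, and its derivative along \<open>W\<close> differs from a multiple
  of that of \<open>F\<close> only by a term of order \<open>g\<^sup>2 - c\<^sup>2\<close>. So everything reduces to a property of a
  quadratic on a subspace: near a zero its value is at most a constant times the squared norm of its
  gradient along the subspace (\<open>quadratic_gradient_inequality_on_subspace\<close>). The base point of the quadratic belongs to
  the same affine face as \<open>x\<close>, so no inequality constraints have to be treated. There are only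
  finitely many sign vectors, and the constants can be chosen uniformly
  (\<open>value_gap_le_subgradient_norm_squared\<close>).
\<close>

section \<open>Quadratics on a subspace\<close>

text \<open>
  The quadratic is \<open>u \<mapsto> \<langle>p, u\<rangle> + \<langle>B u, u\<rangle> / 2\<close>, with gradient \<open>p + B u\<close>, and \<open>\<eta>\<close> bounds the norm of
  the gradient projected to \<open>W\<close>. If \<open>p\<close> is not orthogonal to \<open>W\<close>, the projected gradient stays away
  from \<open>0\<close> near the origin while the values stay bounded. Otherwise let \<open>T\<close> be \<open>B\<close> followed by the
  projection to \<open>W\<close>. The component of \<open>u\<close> in the kernel of \<open>T\<close> changes neither \<open>T u\<close> nor
  \<open>\<langle>B u, u\<rangle>\<close>, and on the orthogonal complement of that kernel \<open>T\<close> is bounded below.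
\<close>

lemma quadratic_gradient_inequality_on_subspace:
  fixes B :: "'a::euclidean_space \<Rightarrow> 'a" and p :: 'a
  assumes "linear B" and sym: "\<And>x y. B x \<bullet> y = x \<bullet> B y" and W: "subspace W"
  shows "\<exists>C>0. \<forall>\<^sub>F u in nhds 0. u \<in> W \<longrightarrow>
           (\<forall>\<eta>. (\<forall>d\<in>W. (p + B u) \<bullet> d \<le> \<eta> * norm d) \<longrightarrow> p \<bullet> u + B u \<bullet> u / 2 \<le> C * \<eta>\<^sup>2)"
proof (cases "\<forall>d\<in>W. p \<bullet> d = 0")
  case True
  interpret B: linear B by fact
  obtain E where E: "E \<subseteq> W" "pairwise orthogonal E" "\<And>x. x \<in> E \<Longrightarrow> norm x = 1"
      "independent E" "span E = W"
    using orthonormal_basis_subspace[OF W] by metis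
  have finE: "finite E"
    using E(4) by (rule independent_imp_finite)
  define T where "T u = (\<Sum>e\<in>E. (B u \<bullet> e) *\<^sub>R e)" for u
  have linT: "linear T"
    by (rule linearI)
       (simp_all add: T_def B.add B.scaleR inner_add_left algebra_simps sum.distrib scaleR_sum_right)
  have TW: "T u \<in> W" for u
    unfolding T_def using E(1) W by (intro subspace_sum subspace_scale) auto
  have T_inner: "T u \<bullet> d = B u \<bullet> d" if "d \<in> W" for u d
  proof -
    have "orthogonal (B u - T u) d"
    proof (rule orthogonal_to_span)
      show "d \<in> span E" using that E(5) by simp
      show "orthogonal (B u - T u) e" if e: "e \<in> E" for e
      proof -
        have "T u \<bullet> e = (\<Sum>f\<in>E. (B u \<bullet> f) * (f \<bullet> e))"
          by (simp add: T_def inner_sum_left)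
        also have "\<dots> = (\<Sum>f\<in>E. if f = e then B u \<bullet> e else 0)"
        proof (rule sum.cong[OF refl])
          fix f assume "f \<in> E"
          then show "(B u \<bullet> f) * (f \<bullet> e) = (if f = e then B u \<bullet> e else 0)"
            using e E(2) E(3)[OF e]
            by (auto simp: pairwise_def orthogonal_def dot_square_norm)
        qed
        also have "\<dots> = B u \<bullet> e" using e finE by simp
        finally show ?thesis by (simp add: orthogonal_def inner_diff_left)
      qed
    qed
    then show ?thesis by (simp add: orthogonal_def inner_diff_left)
  qed
  define N where "N = {k \<in> W. T k = 0}"
  have N: "subspace N"
    using W linT by (auto simp: N_def subspace_def linear_0 linear_add linear_scale)
  define R where "R = {r \<in> W. \<forall>k\<in>N. k \<bullet> r = 0}"
  have R: "subspace R"
    using W by (auto simp: R_def subspace_def inner_add_right)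
  have "\<forall>r\<in>R. T r = 0 \<longrightarrow> r = 0"
    by (auto simp: R_def N_def)
  then obtain l where l: "l > 0" "\<And>r. r \<in> R \<Longrightarrow> norm (T r) \<ge> l * norm r"
    using injective_imp_isometric[OF closed_subspace[OF R] R, of T] linT linear_conv_bounded_linear
    by metis
  have main: "p \<bullet> u + B u \<bullet> u / 2 \<le> 1 / (2 * l) * \<eta>\<^sup>2"
    if u: "u \<in> W" and \<eta>: "\<forall>d\<in>W. (p + B u) \<bullet> d \<le> \<eta> * norm d" for u \<eta>
  proof -
    obtain k r where kr: "k \<in> span N" "\<And>w. w \<in> span N \<Longrightarrow> orthogonal r w" "u = k + r"
      using orthogonal_subspace_decomp_exists[of N u] by metis
    have k: "k \<in> N" using kr(1) N by (simp add: span_eq_iff[THEN iffD2])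
    then have "T k = 0" "k \<in> W" by (auto simp: N_def)
    have rW: "r \<in> W"
      using subspace_diff[OF W u \<open>k \<in> W\<close>] kr(3) by simp
    have rR: "r \<in> R"
      using rW kr(2) by (auto simp: R_def orthogonal_def inner_commute span_base)
    have Tu: "T u = T r"
      using \<open>T k = 0\<close> kr(3) linT by (simp add: linear_add)
    \<comment> \<open>Symmetry of \<open>B\<close> makes the cross term with the kernel component vanish.\<close>
    have "T r \<bullet> k = r \<bullet> B k"
      using T_inner[OF \<open>k \<in> W\<close>] sym by simp
    also have "\<dots> = 0"
      using T_inner[OF rW, of k] \<open>T k = 0\<close> by (simp add: inner_commute)
    finally have "B u \<bullet> u = T r \<bullet> r"
      using T_inner[OF u, of u] Tu kr(3) by (simp add: inner_add_right)
    also have "\<dots> \<le> norm (T r) * norm r" by (rule norm_cauchy_schwarz)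
    also have "\<dots> \<le> norm (T r) * (norm (T r) / l)"
      using l(2)[OF rR] l(1) by (intro mult_left_mono) (auto simp: field_simps)
    finally have 1: "B u \<bullet> u \<le> (norm (T u))\<^sup>2 / l"
      using Tu by (simp add: power2_eq_square)
    have "(norm (T u))\<^sup>2 = T u \<bullet> T u" by (simp add: dot_square_norm)
    also have "\<dots> = (p + B u) \<bullet> T u"
      using T_inner[OF TW] True TW by (simp add: inner_add_left)
    also have "\<dots> \<le> \<eta> * norm (T u)" using \<eta> TW by blast
    finally have "(norm (T u))\<^sup>2 \<le> \<eta> * norm (T u)" .
    moreover have "0 \<le> (norm (T u) - \<eta>)\<^sup>2" by simp
    ultimately have "(norm (T u))\<^sup>2 \<le> \<eta>\<^sup>2"
      by (simp add: power2_eq_square algebra_simps)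
    then have "(norm (T u))\<^sup>2 / l \<le> \<eta>\<^sup>2 / l" using l(1) by (simp add: divide_right_mono)
    then show ?thesis using 1 True u by simp
  qed
  show ?thesis
    using l(1) main by (intro exI[of _ "1 / (2 * l)"]) (auto intro!: always_eventually)
next
  case False
  then obtain d0 where d0: "d0 \<in> W" "p \<bullet> d0 \<noteq> 0" by blast
  define d where "d = (if p \<bullet> d0 > 0 then d0 else - d0)"
  have d: "d \<in> W" "p \<bullet> d > 0"
    using d0 W by (auto simp: d_def subspace_neg)
  then have nd: "norm d > 0" by auto
  have linB: "bounded_linear B"
    using assms(1) by (simp add: linear_conv_bounded_linear)
  \<comment> \<open>A lower bound for the projected gradient near the origin.\<close>
  define e where "e = p \<bullet> d / 2 / norm d"
  have e: "e > 0" using d nd by (simp add: e_def)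
  have contB: "((\<lambda>u. B u) \<longlongrightarrow> 0) (nhds 0)"
    using bounded_linear.tendsto[OF linB filterlim_ident[of "nhds 0"]] linear_0[OF assms(1)]
    by simp
  have "((\<lambda>u. (p + B u) \<bullet> d) \<longlongrightarrow> (p + 0) \<bullet> d) (nhds 0)"
    by (intro tendsto_intros contB)
  then have ev1: "\<forall>\<^sub>F u in nhds 0. (p + B u) \<bullet> d > p \<bullet> d / 2"
    by (rule order_tendstoD) (use d in simp)
  have lin_part: "((\<lambda>u. p \<bullet> u) \<longlongrightarrow> 0) (nhds 0)"
    using tendsto_inner[OF tendsto_const filterlim_ident, of p 0] by simp
  have quad_part: "((\<lambda>u. B u \<bullet> u) \<longlongrightarrow> 0) (nhds 0)"
    using tendsto_inner[OF contB filterlim_ident] by simp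
  have "((\<lambda>u. p \<bullet> u + B u \<bullet> u / 2) \<longlongrightarrow> 0) (nhds 0)"
    using tendsto_add[OF lin_part tendsto_divide[OF quad_part tendsto_const, of 2]] by simp
  then have ev2: "\<forall>\<^sub>F u in nhds 0. p \<bullet> u + B u \<bullet> u / 2 < 1"
    by (rule order_tendstoD) simp
  have "\<forall>\<^sub>F u in nhds 0. u \<in> W \<longrightarrow>
      (\<forall>\<eta>. (\<forall>d\<in>W. (p + B u) \<bullet> d \<le> \<eta> * norm d) \<longrightarrow> p \<bullet> u + B u \<bullet> u / 2 \<le> 1 / e\<^sup>2 * \<eta>\<^sup>2)"
    using ev1 ev2
  proof eventually_elim
    case (elim u)
    show ?case
    proof (intro impI allI)
      fix \<eta> assume "\<forall>d\<in>W. (p + B u) \<bullet> d \<le> \<eta> * norm d"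
      then have "p \<bullet> d / 2 < \<eta> * norm d" using d(1) elim(1) by fastforce
      then have "e < \<eta>" using nd by (simp add: e_def divide_simps)
      then have "e\<^sup>2 \<le> \<eta>\<^sup>2" using e by (intro power_mono) auto
      then have "1 \<le> 1 / e\<^sup>2 * \<eta>\<^sup>2" using e by (simp add: field_simps)
      then show "p \<bullet> u + B u \<bullet> u / 2 \<le> 1 / e\<^sup>2 * \<eta>\<^sup>2" using elim(2) by simp
    qed
  qed
  then show ?thesis using e by (intro exI[of _ "1 / e\<^sup>2"]) auto
qed

section \<open>Subgradients along curves of smoothness\<close>

text \<open>
  Smoothness is only required along the ray in direction \<open>d\<close>: the liminf that defines a regular
  subgradient may be tested on that ray alone.
\<close>

lemma regular_subgradient_le_directional_derivative:
  fixes h :: "'a::euclidean_space \<Rightarrow> ereal"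
  assumes v: "v \<in> regular_subdiff h x"
    and h: "h x = ereal (\<phi> 0)" "\<forall>\<^sub>F t in at_right 0. h (x + t *\<^sub>R d) = ereal (\<phi> t)"
    and D: "(\<phi> has_real_derivative D) (at_right 0)"
  shows "v \<bullet> d \<le> D"
proof (cases "d = 0")
  case True
  have "((\<lambda>t. (\<phi> t - \<phi> 0) / (t - 0)) \<longlongrightarrow> D) (at_right 0)"
    using D by (simp add: has_field_derivative_iff)
  moreover have "\<forall>\<^sub>F t in at_right 0. (\<phi> t - \<phi> 0) / (t - 0) = 0"
    using h(2) by eventually_elim (use h(1) True in simp)
  ultimately have "((\<lambda>t::real. 0::real) \<longlongrightarrow> D) (at_right 0)"
    by (rule Lim_transform_eventually)
  then have "D = 0" 
    by (simp add: tendsto_const_iff)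
  then show ?thesis using True by simp
next
  case False
  have lim: "((\<lambda>t. (\<phi> t - \<phi> 0) / (t - 0)) \<longlongrightarrow> D) (at_right 0)"
    using D by (simp add: has_field_derivative_iff)
  have *: "v \<bullet> d - e * norm d \<le> D" if e: "e > 0" for e :: real
  proof (rule tendsto_lowerbound[OF lim])
    have "ereal (- e) < Liminf (at x) (\<lambda>y. (h y - h x - ereal (v \<bullet> (y - x))) / ereal (norm (y - x)))"
      using v e unfolding regular_subdiff_def by (auto intro: less_le_trans[of _ 0])
    then have ev: "\<forall>\<^sub>F y in at x. ereal (- e) < (h y - h x - ereal (v \<bullet> (y - x))) / ereal (norm (y - x))"
      by (rule less_LiminfD)
    have "((\<lambda>t. x + t *\<^sub>R d) \<longlongrightarrow> x + 0 *\<^sub>R d) (at_right 0)"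
      by (intro tendsto_intros)
    moreover have "\<forall>\<^sub>F t::real in at_right 0. t > 0"
      by (rule eventually_at_right_less)
    then have "\<forall>\<^sub>F t in at_right 0. x + t *\<^sub>R d \<noteq> x"
      by eventually_elim (use False in auto)
    ultimately have "filterlim (\<lambda>t. x + t *\<^sub>R d) (at x) (at_right 0)"
      by (simp add: filterlim_at)
    then have "\<forall>\<^sub>F t in at_right 0. ereal (- e) < (h (x + t *\<^sub>R d) - h x - ereal (v \<bullet> (x + t *\<^sub>R d - x)))
        / ereal (norm (x + t *\<^sub>R d - x))"
      by (rule eventually_compose_filterlim[OF ev])
    moreover have "\<forall>\<^sub>F t::real in at_right 0. t > 0"
      by (rule eventually_at_right_less)
    ultimately show "\<forall>\<^sub>F t in at_right 0. v \<bullet> d - e * norm d \<le> (\<phi> t - \<phi> 0) / (t - 0)"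
      using h(2)
    proof eventually_elim
      case (elim t)
      have "- e < (\<phi> t - \<phi> 0 - t * (v \<bullet> d)) / (t * norm d)"
        using elim False h(1) by simp
      then have "- e * (t * norm d) < \<phi> t - \<phi> 0 - t * (v \<bullet> d)"
        using elim False by (simp add: pos_less_divide_eq)
      then have "(v \<bullet> d - e * norm d) * t \<le> \<phi> t - \<phi> 0"
        by (simp add: algebra_simps)
      then show ?case using elim by (simp add: pos_le_divide_eq)
    qed
  qed simp
  show ?thesis
  proof (rule field_le_epsilon)
    fix e :: real assume "e > 0"
    then show "v \<bullet> d \<le> D + e" using *[of "e / norm d"] False by simp
  qed
qed

section \<open>Sign patterns and the \<open>\<ell>\<^sub>1\<close> norm\<close>

definition sign_vector :: "real ^ 'n \<Rightarrow> real ^ 'n" where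
  "sign_vector x = (\<chi> i. sgn (x $ i))"

lemma finite_range_sign_vector: "finite (range (sign_vector :: real ^ 'n \<Rightarrow> _))"
proof (rule finite_subset)
  show "range (sign_vector :: real ^ 'n \<Rightarrow> _) \<subseteq> vec_lambda ` (UNIV \<rightarrow>\<^sub>E {-1, 0, 1})"
  proof (rule image_subsetI)
    fix x :: "real ^ 'n"
    show "sign_vector x \<in> vec_lambda ` (UNIV \<rightarrow>\<^sub>E {-1, 0, 1})"
      unfolding sign_vector_def by (rule imageI) (auto simp: sgn_real_def split: if_splits)
  qed
  show "finite (vec_lambda ` (UNIV \<rightarrow>\<^sub>E {-1, 0, 1::real}) :: (real ^ 'n) set)"
    by (intro finite_imageI finite_PiE) auto
qed

text \<open>
  The vector \<open>x\<close> may have nonzero entries where \<open>y\<close> vanishes: those contribute to neither side. This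
  makes the identity available both for \<open>y = z\<close> with \<open>x\<close> close to \<open>z\<close>, and for small moves \<open>y\<close> of
  \<open>x\<close> within its own sign pattern.
\<close>

lemma l1_norm_eq_inner_sign_vector:
  assumes "\<And>i. y $ i \<noteq> 0 \<Longrightarrow> sgn (x $ i) = sgn (y $ i)"
  shows "l1_norm y = sign_vector x \<bullet> y"
proof -
  have "\<bar>y $ i\<bar> = sgn (x $ i) * y $ i" for i
    using assms[of i] by (cases "y $ i = 0") (auto simp: abs_sgn mult.commute)
  then show ?thesis by (simp add: l1_norm_def inner_vec_def sign_vector_def)
qed

lemma l1_norm_pos:
  assumes "x \<noteq> 0"
  shows "l1_norm x > 0"
proof -
  obtain i where "x $ i \<noteq> 0" using assms by (metis vec_eq_iff zero_index)
  then show ?thesis unfolding l1_norm_def by (intro sum_pos2[of _ i]) auto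
qed

lemma eventually_sign_preserved:
  fixes z :: "real ^ 'n"
  shows "\<forall>\<^sub>F x in nhds z. \<forall>i. z $ i \<noteq> 0 \<longrightarrow> sgn (x $ i) = sgn (z $ i)"
proof (rule eventually_all_finite)
  fix i
  have lim: "((\<lambda>x. x $ i) \<longlongrightarrow> z $ i) (nhds z)"
    by (intro tendsto_vec_nth filterlim_ident)
  consider "z $ i = 0" | "z $ i > 0" | "z $ i < 0" by linarith
  then show "\<forall>\<^sub>F x in nhds z. z $ i \<noteq> 0 \<longrightarrow> sgn (x $ i) = sgn (z $ i)"
  proof cases
    case 2
    from order_tendstoD(1)[OF lim 2] show ?thesis by eventually_elim (use 2 in auto)
  next
    case 3
    from order_tendstoD(2)[OF lim 3] show ?thesis by eventually_elim (use 3 in auto)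
  qed simp
qed

section \<open>The ratio on one face\<close>

definition l1_over_l2_on :: "real ^ 'n ^ 'm \<Rightarrow> real ^ 'm \<Rightarrow> real ^ 'n \<Rightarrow> ereal" where
  "l1_over_l2_on A b x = ereal (l1_norm x / norm x) + indicator_fun {x. A *v x = b} x"

text \<open>
  For \<open>s\<close> the sign vector of a feasible point, this is the linear space parallel to the relatively
  open cell of feasible points with the same signs.
\<close>

definition face_directions :: "real ^ 'n ^ 'm \<Rightarrow> real ^ 'n \<Rightarrow> (real ^ 'n) set" where
  "face_directions A s = {d. A *v d = 0 \<and> (\<forall>i. s $ i = 0 \<longrightarrow> d $ i = 0)}"

lemma subspace_face_directions: "subspace (face_directions A s)"
  by (auto simp: face_directions_def subspace_def matrix_vector_right_distrib
      matrix_vector_mult_scaleR)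

text \<open>
  The right-hand side is the derivative at \<open>x\<close> of \<open>y \<mapsto> \<langle>s, y\<rangle> / \<parallel>y\<parallel>\<close> in direction \<open>d\<close>, where \<open>s\<close> is the
  sign vector of \<open>x\<close>; the ratio agrees with this smooth function on small moves along \<open>d\<close>. The face directions form a
  subspace, so applying this to \<open>- d\<close> gives the reverse inequality.
\<close>

lemma regular_subgradient_on_face:
  fixes A :: "real ^ 'n ^ 'm"
  assumes v: "v \<in> regular_subdiff (l1_over_l2_on A b) x" and x: "A *v x = b" "x \<noteq> 0"
    and d: "d \<in> face_directions A (sign_vector x)"
  shows "v \<bullet> d \<le> (sign_vector x \<bullet> d) / norm x - l1_norm x * (x \<bullet> d) / norm x ^ 3"
proof -
  define s where "s = sign_vector x"
  define \<phi> where "\<phi> t = s \<bullet> (x + t *\<^sub>R d) / norm (x + t *\<^sub>R d)" for t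
  have sx: "s \<bullet> x = l1_norm x"
    unfolding s_def by (rule l1_norm_eq_inner_sign_vector[symmetric]) simp
  show ?thesis
  proof (rule regular_subgradient_le_directional_derivative[OF v])
    show "l1_over_l2_on A b x = ereal (\<phi> 0)"
      using x sx by (simp add: l1_over_l2_on_def indicator_fun_def \<phi>_def)
    have "((\<lambda>t. x + t *\<^sub>R d) \<longlongrightarrow> x) (at_right 0)"
      by (auto intro!: tendsto_eq_intros)
    then have "\<forall>\<^sub>F t in at_right 0. \<forall>i. x $ i \<noteq> 0 \<longrightarrow> sgn ((x + t *\<^sub>R d) $ i) = sgn (x $ i)"
      by (rule eventually_compose_filterlim[OF eventually_sign_preserved])
    then show "\<forall>\<^sub>F t in at_right 0. l1_over_l2_on A b (x + t *\<^sub>R d) = ereal (\<phi> t)"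
    proof eventually_elim
      case (elim t)
      have "A *v (x + t *\<^sub>R d) = b"
        using d x by (simp add: face_directions_def matrix_vector_right_distrib
            matrix_vector_mult_scaleR)
      moreover have "l1_norm (x + t *\<^sub>R d) = s \<bullet> (x + t *\<^sub>R d)"
        unfolding s_def
      proof (rule l1_norm_eq_inner_sign_vector)
        fix i assume "(x + t *\<^sub>R d) $ i \<noteq> 0"
        then have "x $ i \<noteq> 0"
          using d by (auto simp: face_directions_def sign_vector_def)
        then show "sgn (x $ i) = sgn ((x + t *\<^sub>R d) $ i)" using elim by metis
      qed
      ultimately show ?case by (simp add: l1_over_l2_on_def indicator_fun_def \<phi>_def)
    qed
    have "((\<lambda>t. x + t *\<^sub>R d) has_derivative (\<lambda>t. t *\<^sub>R d)) (at 0)"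
      by (auto intro!: derivative_eq_intros)
    from has_derivative_compose[OF this, of norm "\<lambda>h. h \<bullet> sgn x"]
    have "((\<lambda>t. norm (x + t *\<^sub>R d)) has_derivative (\<lambda>t. (x \<bullet> d / norm x) * t)) (at 0)"
      using has_derivative_norm[OF x(2)]
      by (simp add: sgn_div_norm inner_commute divide_inverse mult_ac)
    then have "((\<lambda>t. norm (x + t *\<^sub>R d)) has_real_derivative (x \<bullet> d / norm x)) (at 0)"
      by (simp only: has_field_derivative_def)
    moreover have "((\<lambda>t. s \<bullet> (x + t *\<^sub>R d)) has_real_derivative (s \<bullet> d)) (at 0)"
      unfolding inner_add_right inner_scaleR_right by (auto intro!: derivative_eq_intros)
    ultimately have "(\<phi> has_real_derivative (s \<bullet> d * norm x - s \<bullet> x * (x \<bullet> d / norm x)) / (norm x * norm x)) (at 0)"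
      unfolding \<phi>_def using x(2) by (auto intro: DERIV_divide[THEN DERIV_cong])
    moreover have "(s \<bullet> d * norm x - s \<bullet> x * (x \<bullet> d / norm x)) / (norm x * norm x)
        = sign_vector x \<bullet> d / norm x - l1_norm x * (x \<bullet> d) / norm x ^ 3"
      using x(2) unfolding sx by (simp add: s_def field_simps power3_eq_cube)
    ultimately show "(\<phi> has_real_derivative
        sign_vector x \<bullet> d / norm x - l1_norm x * (x \<bullet> d) / norm x ^ 3) (at_right 0)"
      by (auto intro: has_field_derivative_at_within)
  qed
qed

section \<open>The growth estimate\<close>

text \<open>
  The core of the argument. Near \<open>z\<close> the quadratic inequality yields
  \<open>w / 2 \<le> K (\<parallel>x\<parallel>\<^sub>1 \<parallel>v\<parallel> + w)\<^sup>2\<close> for \<open>w = g\<^sup>2 - c\<^sup>2\<close> and \<open>g = \<parallel>x\<parallel>\<^sub>1 / \<parallel>x\<parallel>\<close>. The bound \<open>a\<close> on the gap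
  makes \<open>w\<close> so small that its square on the right is absorbed by the left-hand side.
\<close>

lemma value_gap_le_subgradient_norm_squared:
  fixes A :: "real ^ 'n ^ 'm" and z :: "real ^ 'n"
  assumes z: "A *v z = b" "z \<noteq> 0"
  defines "c \<equiv> l1_norm z / norm z"
  shows "\<exists>M>0. \<exists>a>0. \<forall>\<^sub>F x in nhds z. \<forall>v\<in>regular_subdiff (l1_over_l2_on A b) x.
           A *v x = b \<longrightarrow> c < l1_norm x / norm x \<longrightarrow> l1_norm x / norm x < c + a \<longrightarrow>
           l1_norm x / norm x - c \<le> M * (norm v)\<^sup>2"
proof -
  \<comment> \<open>The quadratic \<open>(\<langle>s, y\<rangle>\<^sup>2 - c\<^sup>2 \<parallel>y\<parallel>\<^sup>2) / 2\<close> expanded at \<open>z\<close>: \<open>p s\<close> is its gradient there and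
      \<open>B s\<close> its Hessian.\<close>
  define p where "p s = (s \<bullet> z) *\<^sub>R s - c\<^sup>2 *\<^sub>R z" for s :: "real ^ 'n"
  define B where "B s u = (s \<bullet> u) *\<^sub>R s - c\<^sup>2 *\<^sub>R u" for s u :: "real ^ 'n"
  define W where "W = face_directions A"
  have p_inner: "p s \<bullet> y = (s \<bullet> z) * (s \<bullet> y) - c\<^sup>2 * (z \<bullet> y)" for s y
    by (simp add: p_def inner_diff_left)
  have B_inner: "B s u \<bullet> y = (s \<bullet> u) * (s \<bullet> y) - c\<^sup>2 * (u \<bullet> y)" for s u y
    by (simp add: B_def inner_diff_left)
  let ?good = "\<lambda>C s u. u \<in> W s \<longrightarrow> (\<forall>\<eta>. (\<forall>d\<in>W s. (p s + B s u) \<bullet> d \<le> \<eta> * norm d)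
                  \<longrightarrow> p s \<bullet> u + B s u \<bullet> u / 2 \<le> C * \<eta>\<^sup>2)"
  have "\<exists>C>0. \<forall>\<^sub>F u in nhds 0. ?good C s u" for s
  proof (rule quadratic_gradient_inequality_on_subspace)
    show "linear (B s)"
      by (rule linearI) (simp_all add: B_def algebra_simps inner_add_right)
    show "B s x \<bullet> y = x \<bullet> B s y" for x y
      by (simp add: B_def inner_diff_left inner_diff_right inner_commute)
    show "subspace (W s)" unfolding W_def by (rule subspace_face_directions)
  qed
  then have "\<exists>C. \<forall>s. C s > 0 \<and> (\<forall>\<^sub>F u in nhds 0. ?good (C s) s u)"
    by (intro choice allI)
  then obtain C where C: "\<And>s. C s > 0" "\<And>s. \<forall>\<^sub>F u in nhds 0. ?good (C s) s u"
    by blast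
  let ?S = "range (sign_vector :: real ^ 'n \<Rightarrow> _)"
  define K where "K = (\<Sum>s\<in>?S. C s)"
  have CK: "C s \<le> K" if "s \<in> ?S" for s
    unfolding K_def using that finite_range_sign_vector C(1) by (intro member_le_sum) (auto intro: less_imp_le)
  have K: "K > 0"
    using CK[of "sign_vector z"] C(1)[of "sign_vector z"] by auto
  have c: "c > 0" using l1_norm_pos[OF z(2)] z(2) by (simp add: c_def)
  \<comment> \<open>The factor \<open>2 * c + 1\<close> bounds \<open>g + c\<close>, so \<open>g - c < a\<close> forces \<open>8 * K * (g\<^sup>2 - c\<^sup>2) \<le> 1\<close>; and \<open>R\<close> will
      bound \<open>\<parallel>x\<parallel>\<^sub>1\<close> near \<open>z\<close>.\<close>
  define a where "a = min 1 (1 / (8 * K * (2 * c + 1)))"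
  define R where "R = (c + 1) * (norm z + 1)"
  define M where "M = 8 * K * R\<^sup>2 / c"
  have a: "a > 0" "a \<le> 1" "8 * K * (2 * c + 1) * a \<le> 1"
  proof -
    have D: "8 * K * (2 * c + 1) > 0" using K c by simp
    then show "a > 0" unfolding a_def by simp
    have "a \<le> 1 / (8 * K * (2 * c + 1))" by (simp add: a_def)
    then show "8 * K * (2 * c + 1) * a \<le> 1"
      unfolding pos_le_divide_eq[OF D] by (simp only: mult.commute)
  qed (simp add: a_def)
  have R: "R > 0" unfolding R_def using c by (intro mult_pos_pos add_nonneg_pos) auto
  have M: "M > 0" using K R c by (simp add: M_def)
  have "\<forall>\<^sub>F u in nhds 0. \<forall>s\<in>?S. ?good (C s) s u"
    using finite_range_sign_vector C(2) by (intro eventually_ball_finite) auto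
  moreover have "((\<lambda>x. x - z) \<longlongrightarrow> z - z) (nhds z)"
    by (intro tendsto_diff filterlim_ident tendsto_const)
  ultimately have ev1: "\<forall>\<^sub>F x in nhds z. \<forall>s\<in>?S. ?good (C s) s (x - z)"
    using eventually_compose_filterlim[of "\<lambda>u. \<forall>s\<in>?S. ?good (C s) s u" "nhds 0"] by simp
  have ev2: "\<forall>\<^sub>F x in nhds z. norm x < norm z + 1"
    by (rule order_tendstoD[OF tendsto_norm[OF filterlim_ident]]) simp
  have "\<forall>\<^sub>F x in nhds z. \<forall>v\<in>regular_subdiff (l1_over_l2_on A b) x.
           A *v x = b \<longrightarrow> c < l1_norm x / norm x \<longrightarrow> l1_norm x / norm x < c + a \<longrightarrow>
           l1_norm x / norm x - c \<le> M * (norm v)\<^sup>2"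
    using ev1 ev2 eventually_sign_preserved[of z]
  proof eventually_elim
    case (elim x)
    show ?case
    proof (intro ballI impI)
      fix v
      assume v: "v \<in> regular_subdiff (l1_over_l2_on A b) x" and x: "A *v x = b"
        and gap: "c < l1_norm x / norm x" "l1_norm x / norm x < c + a"
      define g where "g = l1_norm x / norm x"
      define w where "w = g\<^sup>2 - c\<^sup>2"
      define s where "s = sign_vector x"
      have sS: "s \<in> ?S" by (simp add: s_def)
      have x0: "x \<noteq> 0" using gap(1) c by auto
      then have nx: "norm x > 0" by simp
      have g: "c < g" "g < c + a" using gap by (simp_all add: g_def)
      have w_factor: "w = (g - c) * (g + c)" by (simp add: w_def power2_eq_square algebra_simps)
      have w: "w > 0" unfolding w_factor using g c by simp
      have sx: "s \<bullet> x = g * norm x"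
        unfolding s_def using l1_norm_eq_inner_sign_vector[of x x] nx by (simp add: g_def)
      have sz: "s \<bullet> z = c * norm z"
        unfolding s_def using l1_norm_eq_inner_sign_vector[of z x] elim(3) z(2)
        by (simp add: c_def)
      have uW: "x - z \<in> W s"
        using elim(3) x z(1)
        by (auto simp: W_def face_directions_def matrix_vector_mult_diff_distrib s_def
            sign_vector_def sgn_zero_iff)
      have grad: "p s + B s (x - z) = (s \<bullet> x) *\<^sub>R s - c\<^sup>2 *\<^sub>R x"
        by (simp add: p_def B_def algebra_simps inner_diff_right)
      have "p s \<bullet> (x - z) + B s (x - z) \<bullet> (x - z) / 2
          = ((s \<bullet> x)\<^sup>2 - c\<^sup>2 * (x \<bullet> x)) / 2 - ((s \<bullet> z)\<^sup>2 - c\<^sup>2 * (z \<bullet> z)) / 2"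
        by (simp add: p_inner B_inner inner_diff_left inner_diff_right inner_commute[of z x]
            power2_eq_square field_simps)
      also have "\<dots> = w * (norm x)\<^sup>2 / 2"
        by (simp add: sx sz dot_square_norm w_def power_mult_distrib algebra_simps)
      finally have quad: "p s \<bullet> (x - z) + B s (x - z) \<bullet> (x - z) / 2 = w * (norm x)\<^sup>2 / 2" .
      \<comment> \<open>Along the face, the gradient of the quadratic is \<open>g \<parallel>x\<parallel>\<^sup>2\<close> times that of the ratio, plus
          \<open>w\<close> times \<open>x\<close>; this explains the two terms of \<open>\<eta>\<close>.\<close>
      define \<eta> where "\<eta> = norm x * (g * norm x * norm v + w)"
      have "(p s + B s (x - z)) \<bullet> d \<le> \<eta> * norm d" if d: "d \<in> W s" for d
      proof -
        have "- d \<in> face_directions A (sign_vector x)"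
          using d subspace_neg[OF subspace_face_directions] by (simp add: W_def s_def)
        from regular_subgradient_on_face[OF v x x0 this]
        have "(s \<bullet> d) / norm x - g * (x \<bullet> d) / (norm x)\<^sup>2 \<le> v \<bullet> d"
          using nx by (simp add: s_def g_def power2_eq_square power3_eq_cube)
        also have "\<dots> \<le> norm v * norm d" by (rule norm_cauchy_schwarz)
        finally have 1: "(s \<bullet> d) / norm x - g * (x \<bullet> d) / (norm x)\<^sup>2 \<le> norm v * norm d" .
        have "(p s + B s (x - z)) \<bullet> d = g * norm x * (s \<bullet> d) - c\<^sup>2 * (x \<bullet> d)"
          by (simp add: grad sx inner_diff_left)
        also have "\<dots> = g * (norm x)\<^sup>2 * ((s \<bullet> d) / norm x - g * (x \<bullet> d) / (norm x)\<^sup>2) + w * (x \<bullet> d)"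
          using nx by (simp add: w_def power2_eq_square field_simps)
        also have "\<dots> \<le> g * (norm x)\<^sup>2 * (norm v * norm d) + w * (norm x * norm d)"
          using 1 g c w norm_cauchy_schwarz[of x d] by (intro add_mono mult_left_mono) auto
        also have "\<dots> = \<eta> * norm d" by (simp add: \<eta>_def power2_eq_square algebra_simps)
        finally show ?thesis .
      qed
      then have "w * (norm x)\<^sup>2 / 2 \<le> C s * \<eta>\<^sup>2"
        unfolding quad[symmetric] using bspec[OF elim(1) sS] uW by blast
      also have "\<dots> \<le> K * \<eta>\<^sup>2" using CK[OF sS] by (intro mult_right_mono) auto
      also have "\<dots> = (K * (g * norm x * norm v + w)\<^sup>2) * (norm x)\<^sup>2"
        by (simp add: \<eta>_def power_mult_distrib)
      finally have "(w / 2) * (norm x)\<^sup>2 \<le> (K * (g * norm x * norm v + w)\<^sup>2) * (norm x)\<^sup>2"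
        by simp
      then have "w / 2 \<le> K * (g * norm x * norm v + w)\<^sup>2"
        by (rule mult_right_le_imp_le) (use nx in simp)
      also have "\<dots> \<le> K * (2 * (g * norm x * norm v)\<^sup>2 + 2 * w\<^sup>2)"
        using K sum_squares_bound[of "g * norm x * norm v" w]
        by (intro mult_left_mono) (auto simp: power2_sum)
      finally have w1: "w / 2 \<le> 2 * K * (g * norm x * norm v)\<^sup>2 + 2 * K * w\<^sup>2"
        by (simp add: algebra_simps)
      have "w \<le> a * (2 * c + 1)"
        unfolding w_factor using g c a by (intro mult_mono) auto
      then have "8 * K * w \<le> 8 * K * (a * (2 * c + 1))" using K by simp
      also have "\<dots> \<le> 1" using a(3) by (simp add: mult_ac)
      finally have "(8 * K * w) * w \<le> 1 * w" using w by (intro mult_right_mono) auto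
      then have "2 * K * w\<^sup>2 \<le> w / 4" by (simp add: power2_eq_square)
      with w1 have w2: "w \<le> 8 * K * (g * norm x * norm v)\<^sup>2" by linarith
      have "g * norm x \<le> R"
        unfolding R_def using g a(2) c elim(2) by (intro mult_mono) auto
      then have "(g * norm x * norm v)\<^sup>2 \<le> (R * norm v)\<^sup>2"
        using g c by (intro power_mono mult_right_mono) auto
      then have "8 * K * (g * norm x * norm v)\<^sup>2 \<le> 8 * K * (R * norm v)\<^sup>2" using K by simp
      moreover have "(g - c) * c \<le> w"
        unfolding w_factor using g c by (intro mult_left_mono) auto
      ultimately have "(g - c) * c \<le> 8 * K * (R * norm v)\<^sup>2" using w2 by linarith
      then show "l1_norm x / norm x - c \<le> M * (norm v)\<^sup>2"
        using c by (simp add: g_def[symmetric] M_def pos_le_divide_eq power_mult_distrib mult_ac)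
    qed
  qed
  then show ?thesis using M a(1) by blast
qed

section \<open>From the growth estimate to the Kurdyka-Lojasiewicz property\<close>

text \<open>
  Limiting subgradients arise along function values that converge as well, so the nearby regular
  subgradients fall under the hypothesis and the estimate passes to the limit. Squared, the inequality
  with desingularizing function \<open>2 \<surd>M \<surd>\<nu>\<close> is exactly this estimate.
\<close>

lemma KL_at_halfI:
  fixes h :: "'a::euclidean_space \<Rightarrow> ereal"
  assumes fin: "\<bar>h z\<bar> \<noteq> \<infinity>" and "M > 0" "a > 0"
    and ev: "\<forall>\<^sub>F x in nhds z. \<forall>v\<in>regular_subdiff h x. h z < h x \<longrightarrow> h x < h z + ereal a \<longrightarrow>
           real_of_ereal (h x - h z) \<le> M * (norm v)\<^sup>2"
  shows "KL_at (1 / 2) h z"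
proof -
  from ev obtain U where U: "open U" "z \<in> U"
    and est: "\<And>x v. x \<in> U \<Longrightarrow> v \<in> regular_subdiff h x \<Longrightarrow> h z < h x \<Longrightarrow> h x < h z + ereal a \<Longrightarrow>
           real_of_ereal (h x - h z) \<le> M * (norm v)\<^sup>2"
    unfolding eventually_nhds by blast
  obtain c where c: "h z = ereal c" using fin by (cases "h z") auto
  have lim_est: "real_of_ereal (h x - h z) \<le> M * (norm v)\<^sup>2"
    if x: "x \<in> U" "h z < h x" "h x < h z + ereal a" and v: "v \<in> limiting_subdiff h x" for x v
  proof -
    from v obtain xs vs where xs: "xs \<longlonglongrightarrow> x" "(\<lambda>t. h (xs t)) \<longlonglongrightarrow> h x"
      "\<And>t. vs t \<in> regular_subdiff h (xs t)" "vs \<longlonglongrightarrow> v"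
      unfolding limiting_subdiff_def by blast
    obtain r where r: "h x = ereal r" using x c by (cases "h x") auto
    have "((\<lambda>t. h (xs t) - h z) \<longlonglongrightarrow> h x - h z)"
      using xs(2) c r by (intro tendsto_diff_ereal tendsto_const) auto
    then have lim1: "(\<lambda>t. real_of_ereal (h (xs t) - h z)) \<longlonglongrightarrow> real_of_ereal (h x - h z)"
      using c r by (intro lim_real_of_ereal) simp
    have lim2: "(\<lambda>t. M * (norm (vs t))\<^sup>2) \<longlonglongrightarrow> M * (norm v)\<^sup>2"
      by (intro tendsto_intros xs)
    have "\<forall>\<^sub>F t in sequentially. xs t \<in> U"
      using topological_tendstoD[OF xs(1) U(1) x(1)] .
    moreover have "\<forall>\<^sub>F t in sequentially. h z < h (xs t)"
      using order_tendstoD(1)[OF xs(2) x(2)] .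
    moreover have "\<forall>\<^sub>F t in sequentially. h (xs t) < h z + ereal a"
      using order_tendstoD(2)[OF xs(2) x(3)] .
    ultimately have "\<forall>\<^sub>F t in sequentially. real_of_ereal (h (xs t) - h z) \<le> M * (norm (vs t))\<^sup>2"
      by eventually_elim (use est xs(3) in blast)
    then show ?thesis
      using tendsto_le[OF _ lim2 lim1] by simp
  qed
  define a0 where "a0 = 2 * sqrt M"
  have a0: "a0 > 0" using \<open>M > 0\<close> by (simp add: a0_def)
  have "1 \<le> ereal (deriv (\<lambda>\<nu>. a0 * \<nu> powr (1 - 1 / 2)) (real_of_ereal (h x - h z)))
                 * edist_set 0 (limiting_subdiff h x)"
    if x: "x \<in> U" "h z < h x" "h x < h z + ereal a" for x
  proof -
    obtain r where r: "h x = ereal r" using x c by (cases "h x") auto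
    define \<nu> where "\<nu> = real_of_ereal (h x - h z)"
    have \<nu>: "\<nu> > 0" using x c r by (simp add: \<nu>_def)
    have "((\<lambda>\<nu>. a0 * \<nu> powr (1 - 1 / 2)) has_real_derivative sqrt M / sqrt \<nu>) (at \<nu>)"
      using \<nu> by (auto intro!: derivative_eq_intros simp: a0_def powr_minus powr_half_sqrt field_simps)
    then have D: "deriv (\<lambda>\<nu>. a0 * \<nu> powr (1 - 1 / 2)) \<nu> = sqrt M / sqrt \<nu>"
      by (rule DERIV_imp_deriv)
    have "ereal (sqrt \<nu> / sqrt M) \<le> edist_set 0 (limiting_subdiff h x)"
      unfolding edist_set_def
    proof (rule INF_greatest)
      fix v assume "v \<in> limiting_subdiff h x"
      then have "\<nu> \<le> M * (norm v)\<^sup>2" unfolding \<nu>_def by (rule lim_est[OF x])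
      then have "sqrt \<nu> \<le> sqrt M * norm v"
        using \<open>M > 0\<close> real_sqrt_le_mono[of \<nu> "M * (norm v)\<^sup>2"] by (simp add: real_sqrt_mult)
      then show "ereal (sqrt \<nu> / sqrt M) \<le> ereal (dist 0 v)"
        using \<open>M > 0\<close> by (simp add: pos_divide_le_eq mult.commute)
    qed
    then have "ereal (sqrt M / sqrt \<nu>) * ereal (sqrt \<nu> / sqrt M)
        \<le> ereal (sqrt M / sqrt \<nu>) * edist_set 0 (limiting_subdiff h x)"
      using \<nu> \<open>M > 0\<close> by (intro ereal_mult_left_mono) auto
    moreover have "sqrt M / sqrt \<nu> * (sqrt \<nu> / sqrt M) = 1" using \<nu> \<open>M > 0\<close> by simp
    ultimately show ?thesis using D by (simp add: \<nu>_def one_ereal_def)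
  qed
  then show ?thesis
    unfolding KL_at_def using U \<open>a > 0\<close> a0
    by (intro exI[of _ "ereal a"] exI[of _ a0] exI[of _ U]) auto
qed

lemma lsc_add_indicator_closed:
  fixes f :: "'a::t2_space \<Rightarrow> real"
  assumes "closed C" and cont: "\<And>x. x \<in> C \<Longrightarrow> isCont f x"
  shows "lsc (\<lambda>x. ereal (f x) + indicator_fun C x)"
  unfolding lsc_def
proof (intro allI)
  fix x
  let ?h = "\<lambda>x. ereal (f x) + indicator_fun C x"
  show "?h x \<le> Liminf (at x) ?h"
    unfolding le_Liminf_iff
  proof (intro allI impI)
    fix y assume y: "y < ?h x"
    show "\<forall>\<^sub>F u in at x. y < ?h u"
    proof (cases "x \<in> C")
      case True
      then have "((\<lambda>u. ereal (f u)) \<longlongrightarrow> ereal (f x)) (at x)"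
        using cont by (simp add: isCont_def)
      moreover have "y < ereal (f x)" using y True by (simp add: indicator_fun_def)
      ultimately have "\<forall>\<^sub>F u in at x. y < ereal (f u)" by (rule order_tendstoD)
      then show ?thesis by eventually_elim (auto simp: indicator_fun_def)
    next
      case False
      have "\<forall>\<^sub>F u in at x. u \<in> - C"
        using assms(1) False by (intro topological_tendstoD[OF tendsto_ident_at]) auto
      then show ?thesis by eventually_elim (use y False in \<open>auto simp: indicator_fun_def\<close>)
    qed
  qed
qed

section \<open>The exponent of the ratio\<close>

theorem theorem4p4:
  fixes A :: "real ^ 'n ^ 'm" and b :: "real ^ 'm"
  assumes "rank A = CARD('m)"
    and "b \<noteq> 0"
  shows "KL_function (1 / 2)
           (\<lambda>x. ereal (l1_norm x / norm x) + indicator_fun {x. A *v x = b} x)"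
proof -
  let ?h = "\<lambda>x. ereal (l1_norm x / norm x) + indicator_fun {x. A *v x = b} x"
  have h: "?h = l1_over_l2_on A b" by (simp add: fun_eq_iff l1_over_l2_on_def)
  have nonzero: "x \<noteq> 0" if "A *v x = b" for x
    using that assms(2) by auto
  have "surj ((*v) A)" using assms(1) by (simp add: full_rank_surjective)
  then obtain x0 where "A *v x0 = b" by (metis surjD)
  then have proper: "proper ?h"
    by (auto simp: proper_def edom_def indicator_fun_def intro!: exI[of _ x0])
  have closed: "closed {x. A *v x = b}"
    by (intro closed_Collect_eq continuous_intros matrix_vector_mult_linear_continuous_on)
  have lsc: "lsc ?h"
  proof (rule lsc_add_indicator_closed[OF closed])
    fix x assume "x \<in> {x. A *v x = b}"
    then show "isCont (\<lambda>x. l1_norm x / norm x) x"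
      unfolding l1_norm_def using nonzero by (intro continuous_intros) auto
  qed
  have "KL_at (1 / 2) (l1_over_l2_on A b) z" if "z \<in> subdiff_dom ?h" for z
  proof -
    have "z \<in> edom ?h" using that by (auto simp: subdiff_dom_def limiting_subdiff_def)
    then have z: "A *v z = b" by (auto simp: edom_def indicator_fun_def split: if_splits)
    obtain M a where M: "M > 0" "a > 0"
      and ev: "\<forall>\<^sub>F x in nhds z. \<forall>v\<in>regular_subdiff (l1_over_l2_on A b) x.
           A *v x = b \<longrightarrow> l1_norm z / norm z < l1_norm x / norm x \<longrightarrow>
           l1_norm x / norm x < l1_norm z / norm z + a \<longrightarrow>
           l1_norm x / norm x - l1_norm z / norm z \<le> M * (norm v)\<^sup>2"
      using value_gap_le_subgradient_norm_squared[OF z nonzero[OF z]] by blast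
    show ?thesis
    proof (rule KL_at_halfI[OF _ M])
      show "\<bar>l1_over_l2_on A b z\<bar> \<noteq> \<infinity>"
        using z by (simp add: l1_over_l2_on_def indicator_fun_def)
      show "\<forall>\<^sub>F x in nhds z. \<forall>v\<in>regular_subdiff (l1_over_l2_on A b) x.
          l1_over_l2_on A b z < l1_over_l2_on A b x \<longrightarrow>
          l1_over_l2_on A b x < l1_over_l2_on A b z + ereal a \<longrightarrow>
          real_of_ereal (l1_over_l2_on A b x - l1_over_l2_on A b z) \<le> M * (norm v)\<^sup>2"
        using ev
        by eventually_elim (use z in \<open>auto simp: l1_over_l2_on_def indicator_fun_def\<close>)
    qed
  qed
  then show ?thesis using proper lsc by (simp add: KL_function_def h)
qed

end
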